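(* For every positive integer $n \geq 1$ and every real number $a > 0$, there exists an $n$th root $\sqrt[n]{a} > 0$ of $a$; that is, there exists a real number $x > 0$ such that $x^n = a$.
   Context: The set $\mathbb{R}$ of real numbers is an ordered field satisfying the Least Upper Bound Axiom: every non-empty subset of $\mathbb{R}$ that is bounded from above has a least upper bound. For a positive integer $n$ and a real number $a>0$, a number $x$ is called an $n$th root of $a$ if $x^n = a$. The positive $n$th root of $a$, which is unique if it exists, is denoted by $\sqrt[n]{a}$. *)

theory Defs
  imports Complex_Main
begin

end

theory Submission
  imports Defs
begin

text \<open>
  Since \<open>x ^ n\<close> depends continuously on \<open>x\<close>, it suffices by the intermediate value theorem
  (where the Least Upper Bound Axiom enters) to find a point where the power lies below \<open>a\<close>
  and one where it lies above. The point \<open>0\<close> serves as the first, and \<open>1 + a\<close> as the second: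
  a number that is at least \<open>1\<close> does not exceed its positive powers. The point obtained is
  positive because \<open>0 ^ n = 0\<close> is different from \<open>a\<close>.
\<close>

theorem theorem1:
  fixes n :: nat and a :: real
  assumes "n \<ge> 1" and "a > 0"
  shows "\<exists>x::real. x > 0 \<and> x ^ n = a"
proof -
  have low: "0 ^ n \<le> a"
    using assms by (simp add: power_0_left)
  have "1 + a \<le> (1 + a) ^ n"
    using assms by (intro self_le_power) auto
  then have high: "a \<le> (1 + a) ^ n"
    by linarith
  have "continuous_on {0..1 + a} (\<lambda>x. x ^ n)"
    by (intro continuous_intros)
  with low high assms obtain x where "0 \<le> x" and root: "x ^ n = a"
    using IVT'[of "\<lambda>x. x ^ n" 0 a "1 + a"] by auto
  moreover have "x \<noteq> 0"
    using root assms by (auto simp: power_0_left)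
  ultimately show ?thesis
    by (intro exI[of _ x]) simp
qed

end
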